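(* Let $q$ be a prime power, $n\ge 1$, and let $\sigma$ be a generator of $\mathrm{Gal}(\mathbb{F}_{q^n}/\mathbb{F}_q)$. Let $L=a_0x+a_1x^{\sigma}+\dots+a_dx^{\sigma^d}\in\mathbb{F}_{q^n}[x]$ be a $\sigma$-linearized polynomial of $\sigma$-degree $d\ge 1$ (so $a_d\neq 0$) with $a_0\neq 0$, and let $A_L$ be the $d\times d$ matrix defined in the context. Then for every $\alpha\in\mathbb{F}_{q^n}^*$, $$\mathrm{null}(L_\alpha)=\mathrm{null}(A_L-\lambda I),\qquad\text{where }\lambda=N(\alpha).$$ In particular, the nullity of $L$ is equal to the nullity of $A_L-I$.
   Context: $x^\sigma=x^{q^s}$ for some $s$ with $\gcd(s,n)=1$; $x^{\sigma^i}$ denotes $i$-fold application of $\sigma$, and for a matrix $M$ over $\mathbb{F}_{q^n}$, $M^{\sigma}$ denotes $\sigma$ applied entrywise. $N(x)=x^{1+\sigma+\dots+\sigma^{n-1}}$ is the norm from $\mathbb{F}_{q^n}$ to $\mathbb{F}_q$. For $y\in\mathbb{F}_{q^n}$ and $i\ge 0$, $y^{[i]}:=y^{1+\sigma+\dots+\sigma^{i-1}}$ (with $y^{[0]}=1$). A $\sigma$-linearized polynomial $L=\sum a_ix^{\sigma^i}$ defines an $\mathbb{F}_q$-linear map $\mathbb{F}_{q^n}\to\mathbb{F}_{q^n}$; $\mathrm{null}(L)$ denotes the $\mathbb{F}_q$-dimension of its kernel in $\mathbb{F}_{q^n}$. For $\alpha\in\mathbb{F}_{q^n}$, $L_\alpha:=\sum_i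 a_i\alpha^{[i]}x^{\sigma^i}$. The companion matrix of $L$ is the $d\times d$ matrix $C_L$ with $1$'s on the subdiagonal, last column $(-a_0/a_d,-a_1/a_d,\dots,-a_{d-1}/a_d)^T$, and zeros elsewhere; $A_L:=C_LC_L^{\sigma}C_L^{\sigma^2}\cdots C_L^{\sigma^{n-1}}$. The nullity of the matrix $A_L-\lambda I$ is its nullity as a matrix over $\mathbb{F}_{q^n}$. *)

theory Defs
  imports
    "Jordan_Normal_Form.Matrix_Kernel"
    "HOL-Algebra.Embedded_Algebras"
    "HOL-Algebra.Generated_Groups"
    "HOL-Number_Theory.Prime_Powers"
begin

definition galois_group :: "'a::field set \<Rightarrow> ('a \<Rightarrow> 'a) monoid" where
  "galois_group K =
     \<lparr>carrier = {\<tau>. bij \<tau> \<and> (\<forall>x y. \<tau> (x + y) = \<tau> x + \<tau> y) \<and> (\<forall>x y. \<tau> (x * y) = \<tau> x * \<tau> y)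
                    \<and> (\<forall>c\<in>K. \<tau> c = c)},
      monoid.mult = (\<circ>), one = id\<rparr>"

definition galois_generator :: "'a::field set \<Rightarrow> ('a \<Rightarrow> 'a) \<Rightarrow> bool" where
  "galois_generator K \<sigma> \<longleftrightarrow>
     \<sigma> \<in> carrier (galois_group K) \<and>
     generate (galois_group K) {\<sigma>} = carrier (galois_group K)"

text \<open>\<open>sigma_pow \<sigma> y i\<close> is \<open>y\<^sup>[\<^sup>i\<^sup>]\<close>, that is, \<open>y\<close> raised to \<open>1 + \<sigma> + \<dots> + \<sigma>\<close>-to-the-\<open>(i - 1)\<close>.\<close>

definition sigma_pow :: "('a::field \<Rightarrow> 'a) \<Rightarrow> 'a \<Rightarrow> nat \<Rightarrow> 'a" where
  "sigma_pow \<sigma> y i = (\<Prod>j<i. (\<sigma> ^^ j) y)"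

text \<open>For a generator \<open>\<sigma>\<close> of the Galois group of an extension of degree \<open>n\<close>, this is the
  field norm.\<close>

definition sigma_norm :: "('a::field \<Rightarrow> 'a) \<Rightarrow> nat \<Rightarrow> 'a \<Rightarrow> 'a" where
  "sigma_norm \<sigma> n x = (\<Prod>j<n. (\<sigma> ^^ j) x)"

text \<open>A \<open>\<sigma>\<close>-linearized polynomial is given by its coefficients \<open>a 0, \<dots>, a d\<close>; values of \<open>a\<close>
  beyond \<open>d\<close> are irrelevant.\<close>

definition lin_map :: "('a::field \<Rightarrow> 'a) \<Rightarrow> nat \<Rightarrow> (nat \<Rightarrow> 'a) \<Rightarrow> 'a \<Rightarrow> 'a" where
  "lin_map \<sigma> d a x = (\<Sum>i\<le>d. a i * (\<sigma> ^^ i) x)"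

text \<open>Coefficients of \<open>L\<^sub>\<alpha>\<close>.\<close>

definition twist_coeffs :: "('a::field \<Rightarrow> 'a) \<Rightarrow> 'a \<Rightarrow> (nat \<Rightarrow> 'a) \<Rightarrow> nat \<Rightarrow> 'a" where
  "twist_coeffs \<sigma> \<alpha> a i = a i * sigma_pow \<sigma> \<alpha> i"

text \<open>The dimension over the subfield \<open>K\<close> of the kernel of \<open>f\<close> in the whole field.\<close>

definition nullity_over :: "'a::field set \<Rightarrow> ('a \<Rightarrow> 'a) \<Rightarrow> nat" where
  "nullity_over K f = ring.dim class_ring K {x. f x = 0}"

definition companion_matrix :: "nat \<Rightarrow> (nat \<Rightarrow> 'a::field) \<Rightarrow> 'a mat" where
  "companion_matrix d a =
     mat d d (\<lambda>(i, j). if j = d - 1 then - a i / a d else if i = j + 1 then 1 else 0)"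

definition A_matrix :: "('a::field \<Rightarrow> 'a) \<Rightarrow> nat \<Rightarrow> nat \<Rightarrow> (nat \<Rightarrow> 'a) \<Rightarrow> 'a mat" where
  "A_matrix \<sigma> n d a =
     foldr (*) (map (\<lambda>i. map_mat (\<sigma> ^^ i) (companion_matrix d a)) [0..<n]) (1\<^sub>m d)"

end

theory Submission
  imports
    Defs
    "HOL-Library.Function_Algebras"
    "HOL-Computational_Algebra.Polynomial"
    "HOL-Number_Theory.Residues"
begin

text \<open>
  The \<open>\<sigma>\<^sup>-\<^sup>1\<close>-semilinear operator \<open>T v = \<sigma>\<^sup>-\<^sup>1(v C\<^sub>L / \<alpha>)\<close> on row vectors has as fixed points exactly the
  vectors with entries \<open>\<alpha>\<^sup>[\<^sup>j\<^sup>] \<sigma>\<^sup>j(x)\<close>, where \<open>x\<close> is a root of \<open>L\<^sub>\<alpha>\<close>, while \<open>T\<^sup>n v = v A\<^sub>L / N(\<alpha>)\<close>, so that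
  the vectors fixed by \<open>T\<^sup>n\<close> form the left kernel of \<open>A\<^sub>L - N(\<alpha>) I\<close>. By Galois descent a semilinear
  operator satisfies \<open>|ker (T\<^sup>n - 1)| = |ker (T - 1)|\<^sup>n\<close>. Over a finite field dimensions can be read off
  from cardinalities, and the left and right kernels of a square matrix have the same size.
\<close>

section \<open>Left kernels and dimensions by counting\<close>

text \<open>(P A)^T u = A^T (P^T u). Used for an invertible matrix and for its inverse, this carries
  left kernels across row equivalence.\<close>

lemma mat_kernel_transpose_mult:
  fixes A :: "'a::comm_ring_1 mat"
  assumes A: "A \<in> carrier_mat nr nc" and P: "P \<in> carrier_mat nr nr"
    and u: "u \<in> mat_kernel (transpose_mat (P * A))"
  shows "transpose_mat P *\<^sub>v u \<in> mat_kernel (transpose_mat A)"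
proof -
  have PA: "transpose_mat (P * A) \<in> carrier_mat nc nr"
    using A P by simp
  note u' = mat_kernelD[OF PA u]
  have "transpose_mat A *\<^sub>v (transpose_mat P *\<^sub>v u) = transpose_mat (P * A) *\<^sub>v u"
    using A P u'(1) by (simp add: transpose_mult[OF P A] assoc_mult_mat_vec[of _ nc nr _ nr])
  then show ?thesis
    using A P u' by (intro mat_kernelI[of _ nc nr]) auto
qed

text \<open>The pivot column of a nonzero row has a 1 in that row and zeros elsewhere, so its
  equation isolates one coordinate of \<open>u\<close>. Zero rows impose nothing.\<close>

lemma mat_kernel_transpose_row_echelon:
  fixes E :: "'a::field mat"
  assumes E: "E \<in> carrier_mat nr nc" and "row_echelon_form E"
  shows "mat_kernel (transpose_mat E) =
    {u \<in> carrier_vec nr. \<forall>i<nr. row E i \<noteq> 0\<^sub>v nc \<longrightarrow> u $ i = 0}"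
proof -
  obtain f where f: "pivot_fun E f nc"
    using assms unfolding row_echelon_form_def by auto
  have dim: "dim_row E = nr" using E by simp
  note piv = pivot_funD[OF dim f]
  have entry: "(transpose_mat E *\<^sub>v u) $ j = (\<Sum>i<nr. E $$ (i, j) * u $ i)"
    if "u \<in> carrier_vec nr" "j < nc" for u j
    using that E by (simp add: scalar_prod_def atLeast0LessThan)
  show ?thesis
  proof (intro equalityI subsetI)
    fix u assume "u \<in> mat_kernel (transpose_mat E)"
    then have u: "u \<in> carrier_vec nr" and u0: "transpose_mat E *\<^sub>v u = 0\<^sub>v nc"
      using mat_kernelD[of "transpose_mat E" nc nr u] E by auto
    have "u $ i = 0" if i: "i < nr" and "row E i \<noteq> 0\<^sub>v nc" for i
    proof -
      have fi: "f i < nc"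
        using piv(1)[OF i] pivot_fun_zero_row_iff[OF f E i] that by linarith
      have "0 = (\<Sum>k<nr. E $$ (k, f i) * u $ k)"
        using entry[OF u fi] fi u0 by simp
      also have "\<dots> = (\<Sum>k<nr. if k = i then u $ k else 0)"
        using piv(4)[OF i fi] piv(5)[OF i fi] by (intro sum.cong) auto
      finally show ?thesis using i by simp
    qed
    with u show "u \<in> {u \<in> carrier_vec nr. \<forall>i<nr. row E i \<noteq> 0\<^sub>v nc \<longrightarrow> u $ i = 0}" by simp
  next
    fix u :: "'a vec" assume "u \<in> {u \<in> carrier_vec nr. \<forall>i<nr. row E i \<noteq> 0\<^sub>v nc \<longrightarrow> u $ i = 0}"
    then have u: "u \<in> carrier_vec nr" and u0: "\<And>i. i < nr \<Longrightarrow> row E i \<noteq> 0\<^sub>v nc \<Longrightarrow> u $ i = 0"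
      by auto
    have "(\<Sum>i<nr. E $$ (i, j) * u $ i) = 0" if j: "j < nc" for j
    proof (intro sum.neutral ballI)
      fix i assume "i \<in> {..<nr}"
      then have i: "i < nr" by simp
      show "E $$ (i, j) * u $ i = 0"
      proof (cases "row E i = 0\<^sub>v nc")
        case True
        have "E $$ (i, j) = row E i $ j" using E i j by simp
        then show ?thesis using True j by simp
      qed (use u0 i in simp)
    qed
    then have "transpose_mat E *\<^sub>v u = 0\<^sub>v nc"
      using entry[OF u] E by (intro eq_vecI) auto
    then show "u \<in> mat_kernel (transpose_mat E)"
      using u E by (intro mat_kernelI[of _ nc nr]) auto
  qed
qed

lemma card_vec_supported:
  fixes S :: "nat set"
  assumes "S \<subseteq> {..<n}"
  shows "card {u \<in> carrier_vec n. \<forall>i<n. i \<notin> S \<longrightarrow> u $ i = (0::'a::{zero,finite})} =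
    card (UNIV :: 'a set) ^ card S"
proof -
  have S: "i < n" if "i \<in> S" for i using that assms by auto
  have "bij_betw (\<lambda>f. vec n (\<lambda>i. if i \<in> S then f i else 0)) (S \<rightarrow>\<^sub>E (UNIV :: 'a set))
    {u \<in> carrier_vec n. \<forall>i<n. i \<notin> S \<longrightarrow> u $ i = 0}"
    by (rule bij_betw_byWitness[where f' = "\<lambda>u. \<lambda>i\<in>S. u $ i"])
       (auto simp: S PiE_def extensional_def fun_eq_iff)
  from bij_betw_same_card[OF this] show ?thesis
    using assms by (simp add: card_funcsetE finite_subset)
qed

text \<open>After row reduction the left kernel consists of the vectors supported on the zero rows.
  Their number is n minus the rank, which is also the nullity of \<open>A\<close>, so left and right
  kernels have equal size.\<close>

lemma card_mat_kernel_transpose: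
  fixes A :: "'a::{field,finite} mat"
  assumes A: "A \<in> carrier_mat n n"
  shows "card (mat_kernel (transpose_mat A)) = card (UNIV :: 'a set) ^ kernel_dim A"
proof -
  define E where "E = gauss_jordan_single A"
  note gj = gauss_jordan_single[OF A E_def[symmetric]]
  obtain P Q where PQ: "E = P * A" "P \<in> carrier_mat n n" "Q \<in> carrier_mat n n"
      "P * Q = 1\<^sub>m n" "Q * P = 1\<^sub>m n"
    using gj(4) by blast
  have E: "E \<in> carrier_mat n n" and ref: "row_echelon_form E" by (fact gj)+
  \<comment> \<open>Row equivalence read backwards, so that left kernels can also be carried from
    \<open>A\<close> to \<open>E\<close>.\<close>
  have A_eq: "A = Q * E"
    unfolding PQ(1) assoc_mult_mat[OF PQ(3,2) A, symmetric] PQ(5) using A by simp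
  let ?Z = "{i. i < n \<and> row E i = 0\<^sub>v n}" and ?N = "{i. i < n \<and> row E i \<noteq> 0\<^sub>v n}"
  have PQT: "transpose_mat Q * transpose_mat P = 1\<^sub>m n" "transpose_mat P * transpose_mat Q = 1\<^sub>m n"
    by (simp_all flip: transpose_mult[OF PQ(2,3)] transpose_mult[OF PQ(3,2)] add: PQ(4,5))
  have inv: "transpose_mat Q *\<^sub>v (transpose_mat P *\<^sub>v u) = u" "transpose_mat P *\<^sub>v (transpose_mat Q *\<^sub>v u) = u"
    if "u \<in> carrier_vec n" for u
    using that PQ(2,3) PQT assoc_mult_mat_vec[of "transpose_mat Q" n n "transpose_mat P" n u]
      assoc_mult_mat_vec[of "transpose_mat P" n n "transpose_mat Q" n u]
    by simp_all
  have ker: "v \<in> carrier_vec n" if "v \<in> mat_kernel (transpose_mat A) \<or> v \<in> mat_kernel (transpose_mat E)" for v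
    using that A E mat_kernelD(1)[of "transpose_mat A" n n] mat_kernelD(1)[of "transpose_mat E" n n] by auto
  have "bij_betw ((*\<^sub>v) (transpose_mat P)) (mat_kernel (transpose_mat E)) (mat_kernel (transpose_mat A))"
  proof (rule bij_betw_byWitness[where f' = "(*\<^sub>v) (transpose_mat Q)"])
    show "(*\<^sub>v) (transpose_mat P) ` mat_kernel (transpose_mat E) \<subseteq> mat_kernel (transpose_mat A)"
      using mat_kernel_transpose_mult[OF A PQ(2)] PQ(1) by auto
    show "(*\<^sub>v) (transpose_mat Q) ` mat_kernel (transpose_mat A) \<subseteq> mat_kernel (transpose_mat E)"
      using mat_kernel_transpose_mult[OF E PQ(3)] A_eq by auto
  qed (use inv ker in auto)
  from bij_betw_same_card[OF this]
  have "card (mat_kernel (transpose_mat A)) = card (mat_kernel (transpose_mat E))" by simp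
  also have "mat_kernel (transpose_mat E) = {u \<in> carrier_vec n. \<forall>i<n. i \<notin> ?Z \<longrightarrow> u $ i = 0}"
    unfolding mat_kernel_transpose_row_echelon[OF E ref] by auto
  also have "card \<dots> = card (UNIV :: 'a set) ^ card ?Z"
    by (rule card_vec_supported) auto
  also have "card ?Z = kernel_dim A"
  proof -
    \<comment> \<open>Left multiplication by the invertible \<open>P\<close> preserves the right
      kernel, whose dimension for \<open>E\<close> is n minus the number of nonzero rows.\<close>
    have "kernel_dim A = kernel.dim n E"
      using A PQ mat_kernel_mult_eq[OF A PQ(2,3,5)] by (simp add: kernel_dim_def)
    then have "kernel_dim A = n - card ?N"
      using find_base_vectors(6)[OF ref E] by simp
    moreover have "card ?Z + card ?N = card (?Z \<union> ?N)"
      by (rule card_Un_disjoint[symmetric]) auto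
    moreover have "?Z \<union> ?N = {..<n}" by auto
    ultimately show ?thesis by simp
  qed
  finally show ?thesis .
qed


section \<open>Dimensions over a subfield and cardinalities\<close>

lemma (in ring) dim_finite_subspace:
  assumes K: "subfield K R" and E: "finite E" "E \<subseteq> carrier R"
    and E0: "\<zero> \<in> E" and Eadd: "\<And>x y. x \<in> E \<Longrightarrow> y \<in> E \<Longrightarrow> x \<oplus> y \<in> E"
    and Esm: "\<And>k x. k \<in> K \<Longrightarrow> x \<in> E \<Longrightarrow> k \<otimes> x \<in> E"
  shows "dimension (dim K E) K E"
proof -
  \<comment> \<open>The list of all elements of \<open>E\<close> serves as a spanning list; this
    already gives finite dimension.\<close>
  obtain Us where Us: "set Us = E" using finite_list[OF E(1)] by auto
  have "Span K Us = E"
  proof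
    have "combine Ks Vs \<in> E" if "set Ks \<subseteq> K" "set Vs \<subseteq> E" for Ks Vs
      using that by (induction Ks Vs rule: combine.induct) (auto simp: E0 Eadd Esm)
    then show "Span K Us \<subseteq> E"
      using Span_eq_combine_set[OF K, of Us] Us E(2) by auto
    show "E \<subseteq> Span K Us"
      using Span_base_incl[OF K, of Us] Us E(2) by auto
  qed
  then have "finite_dimension K E"
    using Span_finite_dimension[OF K, of Us] Us E(2) by simp
  from finite_dimensionE[OF K this] show ?thesis
    by (simp add: over_def)
qed

text \<open>Coordinates with respect to a basis are unique, so \<open>combine\<close> is a bijection
  from the length-n lists over \<open>K\<close> onto \<open>E\<close>.\<close>

lemma (in ring) card_dimension:
  assumes K: "subfield K R" and "finite K" and dim: "dimension n K E"
  shows "card E = card K ^ n"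
proof -
  obtain Vs where Vs: "set Vs \<subseteq> carrier R" "independent K Vs" "length Vs = n" "Span K Vs = E"
    using exists_base[OF K dim] by auto
  let ?L = "{Ks. set Ks \<subseteq> K \<and> length Ks = n}"
  have E: "x \<in> E \<longleftrightarrow> (\<exists>Ks. set Ks \<subseteq> K \<and> length Ks = n \<and> x = combine Ks Vs)" for x
    using Span_mem_iff_length_version[OF K Vs(1), of x] Vs(3,4) by simp
  have uniq: "\<exists>!Ks. set Ks \<subseteq> K \<and> length Ks = n \<and> x = combine Ks Vs" if "x \<in> E" for x
    using unique_decomposition[OF K Vs(2), of x] Vs(3,4) that by simp
  have "inj_on (\<lambda>Ks. combine Ks Vs) ?L"
  proof (rule inj_onI)
    fix Ks Ls assume KL: "Ks \<in> ?L" "Ls \<in> ?L" "combine Ks Vs = combine Ls Vs"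
    then have "combine Ks Vs \<in> E" using E by auto
    from uniq[OF this] KL show "Ks = Ls" by blast
  qed
  moreover have "E = (\<lambda>Ks. combine Ks Vs) ` ?L" using E by auto
  ultimately have "card E = card ?L" by (simp add: card_image)
  then show ?thesis using card_lists_length_eq[OF \<open>finite K\<close>] by simp
qed

text \<open>Bridge from lists and \<open>Span\<close> to indexed sums in a type-class field. Only
  spanning is kept, which is what the Moore determinant asks for.\<close>

lemma dimension_class_ring_spanning:
  fixes K E :: "'a::field set"
  assumes K: "subfield K class_ring" and dim: "ring.dimension class_ring n K E"
  shows "\<exists>b. \<forall>x\<in>E. \<exists>k. (\<forall>j<n. k j \<in> K) \<and> x = (\<Sum>j<n. k j * b j)"
proof -
  have R: "ring (class_ring :: 'a ring)" by (rule class_ring.ring_axioms)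
  let ?combine = "ring.combine (class_ring :: 'a ring)"
  obtain Vs where Vs: "length Vs = n" "ring.Span class_ring K Vs = E"
    using ring.exists_base[OF R K dim] by auto
  have comb: "?combine Ks Us = (\<Sum>i<length Us. Ks ! i * Us ! i)" if "length Ks = length Us" for Ks Us
    using that
    by (induction Ks Us rule: list_induct2)
       (simp_all add: ring.combine.simps[OF R] class_ring_simps sum.lessThan_Suc_shift
         del: sum.lessThan_Suc)
  show ?thesis
  proof (rule exI[of _ "(!) Vs"], rule ballI)
    fix x assume "x \<in> E"
    then obtain Ks where Ks: "set Ks \<subseteq> K" "length Ks = n" "x = ?combine Ks Vs"
      using ring.Span_mem_iff_length_version[OF R K, of Vs x] Vs by (auto simp: class_ring_simps)
    then show "\<exists>k. (\<forall>j<n. k j \<in> K) \<and> x = (\<Sum>j<n. k j * Vs ! j)"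
      using comb[of Ks Vs] Vs(1) by (intro exI[of _ "(!) Ks"]) (auto simp: subset_iff)
  qed
qed


section \<open>Moore matrices and Galois descent\<close>

text \<open>Artin's argument: the relation at \<open>y * x\<close> minus \<open>g y\<close> times
  the relation at \<open>x\<close> eliminates \<open>g\<close> and leaves a relation on the smaller
  set.\<close>

lemma dedekind_independence:
  fixes S :: "('a::monoid_mult \<Rightarrow> 'b::field) set"
  assumes "finite S"
    and mult: "\<And>f x y. f \<in> S \<Longrightarrow> f (x * y) = f x * f y"
    and one: "\<And>f. f \<in> S \<Longrightarrow> f 1 = 1"
    and zero: "\<And>x. (\<Sum>f\<in>S. u f * f x) = 0"
    and "f \<in> S"
  shows "u f = 0"
  using assms
proof (induction S arbitrary: u f rule: finite_induct)
  case (insert g S)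
  have u0: "u h = 0" if h: "h \<in> S" for h
  proof -
    from h insert.hyps have "h \<noteq> g" by auto
    \<comment> \<open>At a point where \<open>h\<close> and \<open>g\<close> differ, the new
      coefficient of \<open>h\<close> is a nonzero multiple of \<open>u h\<close>.\<close>
    then obtain y where y: "h y \<noteq> g y" by auto
    have "(\<Sum>f\<in>S. u f * (f y - g y) * f x) = 0" for x
    proof -
      have "(\<Sum>f\<in>S. u f * (f y - g y) * f x) = (\<Sum>f\<in>insert g S. u f * (f y - g y) * f x)"
        using insert.hyps by simp
      also have "\<dots> = (\<Sum>f\<in>insert g S. u f * f (y * x)) - g y * (\<Sum>f\<in>insert g S. u f * f x)"
        unfolding sum_distrib_left sum_subtractf[symmetric]
        by (intro sum.cong) (simp_all add: insert.prems(1) algebra_simps)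
      finally show ?thesis unfolding insert.prems(3) by simp
    qed
    from insert.IH[of "\<lambda>f. u f * (f y - g y)", OF _ _ this h]
    have "u h * (h y - g y) = 0" using insert.prems(1,2) by simp
    with y show ?thesis by simp
  qed
  \<comment> \<open>At 1 only the term of \<open>g\<close> survives, and
    \<open>g 1 = 1\<close>.\<close>
  then have "u g = 0"
    using insert.prems(3)[of 1] insert.prems(2)[of g] insert.hyps by (simp cong: sum.cong)
  with u0 insert.prems(4) show ?case by auto
qed simp

text \<open>The \<open>b j\<close> need not be independent: padding a spanning family with zeros is what
  bounds the order of the Galois group below.\<close>

lemma det_moore_nonzero:
  fixes f :: "nat \<Rightarrow> 'a::field \<Rightarrow> 'a" and b :: "nat \<Rightarrow> 'a"
  assumes inj: "inj_on f {..<m}"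
    and add: "\<And>i x y. i < m \<Longrightarrow> f i (x + y) = f i x + f i y"
    and mult: "\<And>i x y. i < m \<Longrightarrow> f i (x * y) = f i x * f i y"
    and one: "\<And>i. i < m \<Longrightarrow> f i 1 = 1"
    and fixK: "\<And>i c. i < m \<Longrightarrow> c \<in> K \<Longrightarrow> f i c = c"
    and span: "\<And>x. \<exists>k. (\<forall>j<m. k j \<in> K) \<and> x = (\<Sum>j<m. k j * b j)"
  shows "det (mat m m (\<lambda>(i, j). f i (b j))) \<noteq> 0"
proof
  let ?B = "mat m m (\<lambda>(i, j). f i (b j))"
  assume "det ?B = 0"
  \<comment> \<open>The transpose gives a relation between the rows, that is, between the
    \<open>f i\<close> at every \<open>b j\<close>. Since the \<open>f i\<close> fix
    \<open>K\<close> and the \<open>b j\<close> span, it extends to all \<open>x\<close>.\<close>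
  then have "det (transpose_mat ?B) = 0" by (subst det_transpose[of _ m]) auto
  then obtain v where v: "v \<in> carrier_vec m" "v \<noteq> 0\<^sub>v m" "transpose_mat ?B *\<^sub>v v = 0\<^sub>v m"
    using det_0_iff_vec_prod_zero[of "transpose_mat ?B" m] by auto
  have vb: "(\<Sum>i<m. v $ i * f i (b j)) = 0" if j: "j < m" for j
  proof -
    have "(transpose_mat ?B *\<^sub>v v) $ j = (\<Sum>i<m. f i (b j) * v $ i)"
      using v(1) j by (simp add: scalar_prod_def atLeast0LessThan)
    then show ?thesis using v(3) j by (simp add: mult.commute)
  qed
  have f0: "f i 0 = 0" if "i < m" for i
    using add[OF that, of 0 0] by (metis add.right_neutral add_left_imp_eq)
  have fsum: "f i (sum g A) = (\<Sum>a\<in>A. f i (g a))" if "i < m" for i and g :: "nat \<Rightarrow> 'a" and A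
    by (induction A rule: infinite_finite_induct) (simp_all add: f0 add that)
  have "(\<Sum>i<m. v $ i * f i x) = 0" for x
  proof -
    obtain k where k: "\<forall>j<m. k j \<in> K" and x: "x = (\<Sum>j<m. k j * b j)" using span by blast
    have "(\<Sum>i<m. v $ i * f i x) = (\<Sum>i<m. \<Sum>j<m. k j * (v $ i * f i (b j)))"
      using k by (simp add: x fsum mult fixK sum_distrib_left mult_ac)
    also have "\<dots> = (\<Sum>j<m. k j * (\<Sum>i<m. v $ i * f i (b j)))"
      by (subst sum.swap) (simp add: sum_distrib_left)
    finally show ?thesis by (simp add: vb)
  qed
  \<comment> \<open>Dedekind's lemma speaks of a set of functions; injectivity of \<open>f\<close>
    lets the coefficients be indexed by the functions themselves.\<close>
  moreover have "(\<Sum>g\<in>f ` {..<m}. v $ (inv_into {..<m} f g) * g x) = (\<Sum>i<m. v $ i * f i x)" for x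
    by (subst sum.reindex[OF inj]) (simp add: inv_into_f_f[OF inj])
  ultimately have vf: "(\<Sum>g\<in>f ` {..<m}. v $ (inv_into {..<m} f g) * g x) = 0" for x
    by simp
  have "v $ (inv_into {..<m} f (f i)) = 0" if "i < m" for i
    by (rule dedekind_independence[where S = "f ` {..<m}" and u = "\<lambda>g. v $ inv_into {..<m} f g", OF _ _ _ vf])
       (use that mult one in auto)
  then have "v $ i = 0" if "i < m" for i
    using that by (metis inj inv_into_f_f lessThan_iff)
  then have "v = 0\<^sub>v m" using v(1) by (intro eq_vecI) auto
  with v(2) show False ..
qed

text \<open>The inverse is given by its entries because these will act as scalars on vectors of an
  arbitrary space.\<close>

lemma det_nonzero_inverse_entries:
  fixes M :: "nat \<Rightarrow> nat \<Rightarrow> 'a::field"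
  assumes "det (mat n n (\<lambda>(i, j). M i j)) \<noteq> 0"
  obtains M' where
    "\<And>i k. i < n \<Longrightarrow> k < n \<Longrightarrow> (\<Sum>j<n. M i j * M' j k) = (if i = k then 1 else 0)"
    "\<And>i k. i < n \<Longrightarrow> k < n \<Longrightarrow> (\<Sum>j<n. M' i j * M j k) = (if i = k then 1 else 0)"
proof -
  let ?B = "mat n n (\<lambda>(i, j). M i j)"
  have B: "?B \<in> carrier_mat n n" by simp
  from det_non_zero_imp_unit[OF B assms, unfolded Units_def, of "()"]
  obtain C where C: "C \<in> carrier_mat n n" "C * ?B = 1\<^sub>m n" "?B * C = 1\<^sub>m n"
    by (auto simp: ring_mat_def)
  show ?thesis
  proof (rule that[of "\<lambda>i j. C $$ (i, j)"])
    fix i k assume ik: "i < n" "k < n"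
    have "(?B * C) $$ (i, k) = (\<Sum>j<n. M i j * C $$ (j, k))"
      using ik C(1) by (simp add: scalar_prod_def atLeast0LessThan)
    then show "(\<Sum>j<n. M i j * C $$ (j, k)) = (if i = k then 1 else 0)" using C(3) ik by simp
    have "(C * ?B) $$ (i, k) = (\<Sum>j<n. C $$ (i, j) * M j k)"
      using ik C(1) by (simp add: scalar_prod_def atLeast0LessThan)
    then show "(\<Sum>j<n. C $$ (i, j) * M j k) = (if i = k then 1 else 0)" using C(2) ik by simp
  qed
qed

text \<open>This is Galois descent by counting: a vector \<open>w\<close> with \<open>T\<^sup>n w = w\<close> has unique coordinates with
  respect to \<open>b\<close> among the fixed vectors of \<open>T\<close>, because applying powers of \<open>T\<close> to
  \<open>w = \<Sum>\<^sub>j b\<^sub>j w\<^sub>j\<close> gives a linear system for the \<open>w\<^sub>j\<close> whose matrix is the Moore matrix of \<open>b\<close>.\<close>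

lemma card_fixed_points_semilinear:
  fixes scale :: "'a::field \<Rightarrow> 'b::ab_group_add \<Rightarrow> 'b" and T :: "'b \<Rightarrow> 'b"
    and \<tau> :: "'a \<Rightarrow> 'a" and b :: "nat \<Rightarrow> 'a"
  assumes vs: "vector_space scale"
    and add: "\<And>x y. T (x + y) = T x + T y"
    and semi: "\<And>c x. T (scale c x) = scale (\<tau> c) (T x)"
    and n: "n > 0" and \<tau>n: "\<tau> ^^ n = id"
    and det: "det (mat n n (\<lambda>(i, j). (\<tau> ^^ i) (b j))) \<noteq> 0"
  shows "card {v. (T ^^ n) v = v} = card {v. T v = v} ^ n"
proof -
  interpret vector_space scale by (rule vs)
  let ?W = "{v. (T ^^ n) v = v}" and ?Fix = "{v. T v = v}"
  obtain B where
    B1: "\<And>i k. i < n \<Longrightarrow> k < n \<Longrightarrow> (\<Sum>j<n. (\<tau> ^^ i) (b j) * B j k) = (if i = k then 1 else 0)" and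
    B2: "\<And>i k. i < n \<Longrightarrow> k < n \<Longrightarrow> (\<Sum>j<n. B i j * (\<tau> ^^ j) (b k)) = (if i = k then 1 else 0)"
    using det_nonzero_inverse_entries[OF det] by blast
  have T0: "T 0 = 0" using add[of 0 0] by simp
  have Tsum: "T (\<Sum>j<n. scale (c j) (w j)) = (\<Sum>j<n. scale (\<tau> (c j)) (T (w j)))" for c w
  proof -
    have "T (\<Sum>j\<in>A. scale (c j) (w j)) = (\<Sum>j\<in>A. scale (\<tau> (c j)) (T (w j)))" for A
      by (induction A rule: infinite_finite_induct) (simp_all add: T0 add semi)
    then show ?thesis .
  qed
  have comb_fixed: "(T ^^ i) (\<Sum>j<n. scale (b j) (w j)) = (\<Sum>j<n. scale ((\<tau> ^^ i) (b j)) (w j))"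
    if "\<And>j. j < n \<Longrightarrow> T (w j) = w j" for w i
    by (induction i) (auto simp: Tsum that)
  \<comment> \<open>The inverse Moore matrix applied to w, T w, ..., T^(n-1) w. Restriction to
    \<open>{..<n}\<close> places the result in the extensional function space that is
    counted.\<close>
  define g where "g w = (\<lambda>j\<in>{..<n}. \<Sum>i<n. scale (B j i) ((T ^^ i) w))" for w
  \<comment> \<open>\<open>solve\<close> is uniqueness for the Moore system and rests on
    \<open>B2\<close>; \<open>gsum\<close> is existence and rests on \<open>B1\<close>.\<close>
  have solve: "w j = (\<Sum>i<n. scale (B j i) (y i))"
    if y: "\<And>i. i < n \<Longrightarrow> (\<Sum>k<n. scale ((\<tau> ^^ i) (b k)) (w k)) = y i" and j: "j < n" for w y j
  proof -
    have "(\<Sum>i<n. scale (B j i) (y i)) = (\<Sum>i<n. \<Sum>k<n. scale (B j i * (\<tau> ^^ i) (b k)) (w k))"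
      by (simp add: y[symmetric] scale_sum_right)
    also have "\<dots> = (\<Sum>k<n. scale (\<Sum>i<n. B j i * (\<tau> ^^ i) (b k)) (w k))"
      by (subst sum.swap) (simp add: scale_sum_left)
    also have "\<dots> = (\<Sum>k<n. if k = j then w k else 0)"
      using j by (intro sum.cong) (auto simp: B2)
    finally show ?thesis using j by simp
  qed
  have gsum: "(\<Sum>k<n. scale ((\<tau> ^^ i) (b k)) (g w k)) = (T ^^ i) w" if i: "i < n" for i w
  proof -
    have "(\<Sum>k<n. scale ((\<tau> ^^ i) (b k)) (g w k))
        = (\<Sum>k<n. \<Sum>l<n. scale ((\<tau> ^^ i) (b k) * B k l) ((T ^^ l) w))"
      by (simp add: g_def scale_sum_right)
    also have "\<dots> = (\<Sum>l<n. scale (\<Sum>k<n. (\<tau> ^^ i) (b k) * B k l) ((T ^^ l) w))"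
      by (subst sum.swap) (simp add: scale_sum_left)
    also have "\<dots> = (\<Sum>l<n. if l = i then (T ^^ l) w else 0)"
      using i by (intro sum.cong) (auto simp: B1)
    finally show ?thesis using i by simp
  qed
  have g_fixed: "T (g w j) = g w j" if w: "(T ^^ n) w = w" and j: "j < n" for w j
  proof -
    \<comment> \<open>The vectors \<open>T (g w k)\<close> solve the same system as the
      \<open>g w k\<close>: applying T to equation i - 1 gives equation i, and equation 0 comes from
      equation n - 1 because T^n w = w and \<tau>^n = id. Uniqueness then applies.\<close>
    have "(\<Sum>k<n. scale ((\<tau> ^^ i) (b k)) (T (g w k))) = (T ^^ i) w" if i: "i < n" for i
    proof (cases i)
      case 0
      from n obtain m where m: "n = Suc m" by (cases n) auto
      have "T (\<Sum>k<n. scale ((\<tau> ^^ m) (b k)) (g w k)) = T ((T ^^ m) w)"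
        using gsum[of m w] m by simp
      moreover have "\<tau> ((\<tau> ^^ m) x) = x" for x
        using \<tau>n m by (simp add: fun_eq_iff)
      ultimately show ?thesis using w m 0 by (simp add: Tsum[unfolded m] del: sum.lessThan_Suc)
    next
      case (Suc m)
      then have "T (\<Sum>k<n. scale ((\<tau> ^^ m) (b k)) (g w k)) = T ((T ^^ m) w)"
        using gsum[of m w] i by simp
      then show ?thesis by (simp add: Tsum Suc)
    qed
    from solve[OF this j] show ?thesis using j by (simp add: g_def)
  qed
  have "bij_betw (\<lambda>w. \<Sum>j<n. scale (b j) (w j)) ({..<n} \<rightarrow>\<^sub>E ?Fix) ?W"
  proof (rule bij_betw_byWitness[where f' = g])
    show "\<forall>w\<in>{..<n} \<rightarrow>\<^sub>E ?Fix. g (\<Sum>j<n. scale (b j) (w j)) = w"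
    proof
      fix w assume w: "w \<in> {..<n} \<rightarrow>\<^sub>E ?Fix"
      then have fixd: "T (w j) = w j" if "j < n" for j using that by auto
      have "w j = (\<Sum>i<n. scale (B j i) ((T ^^ i) (\<Sum>j<n. scale (b j) (w j))))" if "j < n" for j
        by (rule solve[OF _ that]) (simp add: comb_fixed fixd)
      then have "g (\<Sum>j<n. scale (b j) (w j)) j = w j" if "j < n" for j
        using that unfolding g_def by (simp flip: lessThan_iff)
      then show "g (\<Sum>j<n. scale (b j) (w j)) = w"
        using w by (intro extensionalityI[of _ "{..<n}"]) (auto simp: g_def PiE_def)
    qed
    show "\<forall>w\<in>?W. (\<Sum>j<n. scale (b j) (g w j)) = w"
      using gsum[of 0] n by simp
    show "(\<lambda>w. \<Sum>j<n. scale (b j) (w j)) ` ({..<n} \<rightarrow>\<^sub>E ?Fix) \<subseteq> ?W"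
    proof
      fix v assume "v \<in> (\<lambda>w. \<Sum>j<n. scale (b j) (w j)) ` ({..<n} \<rightarrow>\<^sub>E ?Fix)"
      then obtain w where w: "w \<in> {..<n} \<rightarrow>\<^sub>E ?Fix" and v: "v = (\<Sum>j<n. scale (b j) (w j))" by auto
      have "T (w j) = w j" if "j < n" for j using w that by auto
      from comb_fixed[of w n, OF this] show "v \<in> ?W" by (simp add: v \<tau>n)
    qed
    show "g ` ?W \<subseteq> {..<n} \<rightarrow>\<^sub>E ?Fix"
      using g_fixed by (auto simp: PiE_def) (simp add: g_def)
  qed
  from bij_betw_same_card[OF this] show ?thesis by (simp add: card_funcsetE)
qed


section \<open>The Galois group of a finite field extension\<close>

lemma galois_groupD:
  assumes "\<tau> \<in> carrier (galois_group K)"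
  shows "bij \<tau>" "\<tau> (x + y) = \<tau> x + \<tau> y" "\<tau> (x * y) = \<tau> x * \<tau> y" "c \<in> K \<Longrightarrow> \<tau> c = c"
    "\<tau> 0 = 0" "\<tau> 1 = 1"
proof -
  show bij: "bij \<tau>" and add: "\<tau> (x + y) = \<tau> x + \<tau> y" and mult: "\<tau> (x * y) = \<tau> x * \<tau> y"
    and "c \<in> K \<Longrightarrow> \<tau> c = c" for x y
    using assms by (auto simp: galois_group_def)
  show zero: "\<tau> 0 = 0" using add[of 0 0] by (metis add.right_neutral add_left_imp_eq)
  \<comment> \<open>A nonzero idempotent of a field is 1.\<close>
  have "\<tau> 1 \<noteq> 0" using bij zero by (metis bij_is_inj injD zero_neq_one)
  then show "\<tau> 1 = 1" using mult[of 1 1] by simp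
qed

lemma galois_group_closed:
  assumes "\<tau> \<in> carrier (galois_group K)"
  shows "inv_into UNIV \<tau> \<in> carrier (galois_group K)" "\<tau> ^^ i \<in> carrier (galois_group K)"
proof -
  note \<tau> = galois_groupD[OF assms]
  have s: "\<tau> (inv_into UNIV \<tau> x) = x" "inv_into UNIV \<tau> (\<tau> x) = x" for x
    using \<tau>(1) by (simp_all add: surj_f_inv_f bij_is_surj bij_is_inj)
  show "inv_into UNIV \<tau> \<in> carrier (galois_group K)"
    unfolding galois_group_def
  proof (simp, intro conjI allI ballI)
    show "bij (inv_into UNIV \<tau>)" using \<tau>(1) by (rule bij_imp_bij_inv)
    show "inv_into UNIV \<tau> (x + y) = inv_into UNIV \<tau> x + inv_into UNIV \<tau> y" "inv_into UNIV \<tau> (x * y) = inv_into UNIV \<tau> x * inv_into UNIV \<tau> y" for x y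
      by (metis s \<tau>(2)) (metis s \<tau>(3))
    show "inv_into UNIV \<tau> c = c" if "c \<in> K" for c
      by (metis s(2) \<tau>(4) that)
  qed
  show "\<tau> ^^ i \<in> carrier (galois_group K)"
  proof -
    have "(\<tau> ^^ i) (x + y) = (\<tau> ^^ i) x + (\<tau> ^^ i) y" "(\<tau> ^^ i) (x * y) = (\<tau> ^^ i) x * (\<tau> ^^ i) y"
      "c \<in> K \<Longrightarrow> (\<tau> ^^ i) c = c" for x y c
      by (induction i) (simp_all add: \<tau>)
    with bij_fn[OF \<tau>(1)] show ?thesis by (simp add: galois_group_def)
  qed
qed

lemma group_galois_group: "group (galois_group K)"
proof (rule groupI)
  fix x assume x: "x \<in> carrier (galois_group K)"
  have "inv_into UNIV x \<otimes>\<^bsub>galois_group K\<^esub> x = \<one>\<^bsub>galois_group K\<^esub>"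
    using galois_groupD(1)[OF x] by (simp add: galois_group_def bij_is_inj)
  with galois_group_closed(1)[OF x]
  show "\<exists>y\<in>carrier (galois_group K). y \<otimes>\<^bsub>galois_group K\<^esub> x = \<one>\<^bsub>galois_group K\<^esub>"
    by blast
qed (auto simp: galois_group_def bij_comp)

lemma galois_group_pow:
  fixes i :: nat
  shows "\<tau> [^]\<^bsub>galois_group K\<^esub> i = \<tau> ^^ i"
  by (induction i) (simp_all add: galois_group_def nat_pow_def funpow_swap1 fun_eq_iff)

text \<open>With n + 1 automorphisms, the Moore matrix of the family padded by one zero would be
  nonsingular, yet its last column vanishes.\<close>

lemma card_galois_group_le:
  fixes b :: "nat \<Rightarrow> 'a::{field,finite}"
  assumes K0: "0 \<in> K" and span: "\<And>x. \<exists>k. (\<forall>j<n. k j \<in> K) \<and> x = (\<Sum>j<n. k j * b j)"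
  shows "card (carrier (galois_group K)) \<le> n"
proof (rule ccontr)
  let ?G = "carrier (galois_group K)"
  assume "\<not> card ?G \<le> n"
  then obtain S where S: "S \<subseteq> ?G" "card S = Suc n" "finite S"
    using obtain_subset_with_card_n[of "Suc n" ?G] by auto
  then obtain f where f: "bij_betw f {..<Suc n} S"
    using ex_bij_betw_nat_finite[of S] by (auto simp: atLeast0LessThan)
  define b' where "b' j = (if j < n then b j else 0)" for j
  let ?M = "mat (Suc n) (Suc n) (\<lambda>(i, j). f i (b' j))"
  have G: "f i \<in> ?G" if "i < Suc n" for i
    using f S that by (auto simp: bij_betw_def)
  have "det ?M \<noteq> 0"
  proof (rule det_moore_nonzero)
    show "inj_on f {..<Suc n}" using f by (simp add: bij_betw_def)
    fix x
    obtain k where "\<forall>j<n. k j \<in> K" "x = (\<Sum>j<n. k j * b j)" using span by blast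
    then show "\<exists>k. (\<forall>j<Suc n. k j \<in> K) \<and> x = (\<Sum>j<Suc n. k j * b' j)"
      by (intro exI[of _ "\<lambda>j. if j < n then k j else 0"]) (auto simp: b'_def K0)
  qed (use galois_groupD[OF G] in auto)
  moreover have "?M *\<^sub>v unit_vec (Suc n) n = 0\<^sub>v (Suc n)"
    using galois_groupD(5)[OF G] by (intro eq_vecI) (auto simp: b'_def)
  then have "det ?M = 0"
    by (subst det_0_iff_vec_prod_zero[of _ "Suc n"])
       (auto intro!: exI[of _ "unit_vec (Suc n) n"] dest: arg_cong[where f = "\<lambda>v. v $ n"])
  ultimately show False by contradiction
qed

text \<open>Fermat's argument: multiplication by a nonzero \<open>x\<close> permutes the nonzero
  elements of \<open>K\<close>; compare their products.\<close>

lemma subfield_power_card: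
  fixes K :: "'a::{field,finite} set"
  assumes mult: "\<And>x y. x \<in> K \<Longrightarrow> y \<in> K \<Longrightarrow> x * y \<in> K" and "0 \<in> K" and x: "x \<in> K"
  shows "x ^ card K = x"
proof (cases "x = 0")
  case True
  then show ?thesis using \<open>0 \<in> K\<close> by (metis card_gt_0_iff empty_iff finite power_0_left less_irrefl)
next
  case False
  let ?U = "K - {0}"
  have "inj_on ((*) x) ?U" using False by (auto intro: inj_onI)
  moreover have "(*) x ` ?U \<subseteq> ?U" using False mult x by auto
  ultimately have "(*) x ` ?U = ?U" by (intro endo_inj_surj) auto
  with \<open>inj_on ((*) x) ?U\<close> have "(\<Prod>y\<in>?U. y) = (\<Prod>y\<in>?U. x * y)"
    by (metis (no_types, lifting) prod.reindex_cong)
  also have "\<dots> = x ^ card ?U * (\<Prod>y\<in>?U. y)" by (simp add: prod.distrib)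
  finally have "x ^ card ?U = 1" by simp
  moreover have "card K = Suc (card ?U)"
    using \<open>0 \<in> K\<close> by (metis card.remove finite)
  ultimately show ?thesis by simp
qed

text \<open>The first n powers of the q-Frobenius, starting with the identity, are distinct
  automorphisms over \<open>K\<close>. The matching upper bound is
  \<open>card_galois_group_le\<close>.\<close>

lemma le_card_galois_group:
  fixes K :: "'a::finite_field set"
  assumes q: "primepow q" and card: "card (UNIV :: 'a set) = q ^ n" "card K = q"
    and K: "\<And>x y. x \<in> K \<Longrightarrow> y \<in> K \<Longrightarrow> x * y \<in> K" "0 \<in> K"
  shows "n \<le> card (carrier (galois_group K))"
proof -
  obtain p k where pk: "prime p" "k > 0" "q = p ^ k"
    using q by (auto simp: primepow_def)
  have q2: "q > 1" using primepow_gt_Suc_0[OF q] by simp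
  \<comment> \<open>The characteristic is a prime dividing q^n, hence p; so raising to the power q^i
    = p^(k i) is additive.\<close>
  have "CHAR('a) dvd p ^ (k * n)"
    using CHAR_dvd_CARD[where 'a = 'a] card(1) pk(3) by (simp add: power_mult)
  then have char: "CHAR('a) = p"
    using CHAR_prime[where 'a = 'a] pk(1) by (metis prime_dvd_power primes_dvd_imp_eq)
  define F where "F i x = x ^ (q ^ i)" for i and x :: 'a
  have add: "F i (x + y) = F i x + F i y" for i x y
    unfolding F_def by (rule freshmans_dream'[where n = "k * i"]) (auto simp: char pk power_mult)
  have inj: "inj (F i)" for i
  proof (rule injI)
    fix x y assume "F i x = F i y"
    then have "F i (x - y) = 0" using add[of i "x - y" y] by simp
    then show "x = y" by (simp add: F_def)
  qed
  have "F i c = c" if "c \<in> K" for i c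
  proof (induction i)
    case (Suc i)
    have "F (Suc i) c = (F i c) ^ q" by (simp add: F_def mult.commute flip: power_mult)
    then show ?case using subfield_power_card[OF K that] card(2) Suc by simp
  qed (simp add: F_def)
  then have "F i \<in> carrier (galois_group K)" for i
    using inj finite_UNIV_inj_surj[OF _ inj] add
    by (auto simp: galois_group_def bij_def F_def power_mult_distrib)
  moreover have "inj_on F {..<n}"
  proof (rule linorder_inj_onI)
    fix i j assume ij: "i < j" "i \<in> {..<n}" "j \<in> {..<n}"
    \<comment> \<open>If \<open>F i = F j\<close>, cancelling \<open>F i\<close> makes all q^n field
      elements roots of X^(q^(j-i)) - X, whose degree is smaller than q^n.\<close>
    let ?p = "Polynomial.monom 1 (q ^ (j - i)) - Polynomial.monom 1 1 :: 'a poly"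
    have m: "1 < q ^ (j - i)" using q2 ij by (intro one_less_power) auto
    show "F i \<noteq> F j"
    proof
      assume "F i = F j"
      moreover have "q ^ (j - i) * q ^ i = q ^ j" using ij by (simp flip: power_add)
      then have "F i (F (j - i) x) = F j x" for x
        by (simp add: F_def flip: power_mult)
      ultimately have "F i x = F i (F (j - i) x)" for x by simp
      then have "F (j - i) x = x" for x
        using inj by (metis injD)
      then have "{x. poly ?p x = 0} = UNIV"
        by (simp add: poly_monom F_def)
      moreover have "Polynomial.coeff ?p (q ^ (j - i)) = 1" using m by simp
      then have "?p \<noteq> 0" by (metis coeff_0 zero_neq_one)
      ultimately have "q ^ n \<le> Polynomial.degree ?p" using card_poly_roots_bound[of ?p] card(1) by simp
      also have "Polynomial.degree ?p \<le> q ^ (j - i)"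
        using m by (intro degree_diff_le) (auto simp: degree_monom_eq)
      also have "\<dots> < q ^ n" using q2 ij by (intro power_strict_increasing) auto
      finally show False by simp
    qed
  qed auto
  moreover have "finite (carrier (galois_group K))" by simp
  ultimately show ?thesis
    using card_inj_on_le[of F "{..<n}" "carrier (galois_group K)"] by auto
qed

text \<open>The order of an element is the size of the subgroup it generates, here the whole
  group.\<close>

lemma galois_generator_order:
  assumes "galois_generator K \<sigma>" and n: "card (carrier (galois_group K)) = n" "n > 0"
  shows "\<sigma> ^^ n = id" "inj_on (\<lambda>i. \<sigma> ^^ i) {..<n}"
proof -
  interpret G: group "galois_group K" by (rule group_galois_group)
  have \<sigma>: "\<sigma> \<in> carrier (galois_group K)" and "G.ord \<sigma> = n"
    using assms G.generate_pow_card[of \<sigma>] by (auto simp: galois_generator_def)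
  then show "\<sigma> ^^ n = id"
    using G.pow_ord_eq_1[OF \<sigma>] by (simp add: galois_group_pow) (simp add: galois_group_def)
  have "{0..n - 1} = {..<n}" using n by auto
  then show "inj_on (\<lambda>i. \<sigma> ^^ i) {..<n}"
    using G.ord_inj[OF \<sigma>] \<open>G.ord \<sigma> = n\<close> by (simp add: galois_group_pow)
qed


section \<open>The companion operator\<close>

lemma galois_group_eq_0_iff:
  assumes "\<tau> \<in> carrier (galois_group K)"
  shows "\<tau> x = 0 \<longleftrightarrow> x = 0"
  using inj_eq[OF bij_is_inj[OF galois_groupD(1)[OF assms]], of x 0] galois_groupD(5)[OF assms] by simp

lemma galois_group_divide:
  assumes "\<tau> \<in> carrier (galois_group K)"
  shows "\<tau> (x / y) = \<tau> x / \<tau> y"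
proof (cases "y = 0")
  case False
  then have "\<tau> y \<noteq> 0" by (simp add: galois_group_eq_0_iff[OF assms])
  moreover have "\<tau> (x / y) * \<tau> y = \<tau> x"
    using galois_groupD(3)[OF assms, of "x / y" y] False by simp
  ultimately show ?thesis by (simp add: field_simps)
qed (simp add: galois_groupD(5)[OF assms])

lemma galois_group_sum:
  assumes "\<tau> \<in> carrier (galois_group K)"
  shows "\<tau> (sum g I) = (\<Sum>i\<in>I. \<tau> (g i))"
  by (induction I rule: infinite_finite_induct) (simp_all add: galois_groupD[OF assms])

lemma lin_map_linear:
  assumes "\<sigma> \<in> carrier (galois_group K)"
  shows "lin_map \<sigma> d a (x + y) = lin_map \<sigma> d a x + lin_map \<sigma> d a y"
    and "c \<in> K \<Longrightarrow> lin_map \<sigma> d a (c * x) = c * lin_map \<sigma> d a x"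
    and "lin_map \<sigma> d a 0 = 0"
  by (simp_all add: lin_map_def galois_groupD[OF galois_group_closed(2)[OF assms]]
      sum.distrib sum_distrib_left algebra_simps)

text \<open>The kernel is a finite \<open>K\<close>-subspace, so \<open>nullity_over\<close> can be
  traded for a count of roots.\<close>

lemma card_kernel_lin_map:
  fixes K :: "'a::{field,finite} set"
  assumes K: "subfield K class_ring" and \<sigma>: "\<sigma> \<in> carrier (galois_group K)"
  shows "card {x. lin_map \<sigma> d a x = 0} = card K ^ nullity_over K (lin_map \<sigma> d a)"
proof -
  note R = class_ring.ring_axioms
  have "ring.dimension class_ring (nullity_over K (lin_map \<sigma> d a)) K {x. lin_map \<sigma> d a x = 0}"
    unfolding nullity_over_def
    by (rule ring.dim_finite_subspace[OF R K]) (auto simp: class_ring_simps lin_map_linear[OF \<sigma>])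
  from ring.card_dimension[OF R K _ this] show ?thesis by simp
qed

section \<open>Recursions for the twisted products\<close>

lemma foldr_mult_mat:
  fixes X :: "'a::semiring_1 mat"
  assumes "\<And>M. M \<in> set Ms \<Longrightarrow> M \<in> carrier_mat d d" and "X \<in> carrier_mat d d"
  shows "foldr (*) Ms (1\<^sub>m d) \<in> carrier_mat d d"
    and "foldr (*) Ms X = foldr (*) Ms (1\<^sub>m d) * X"
proof -
  have *: "foldr (*) Ms (1\<^sub>m d) \<in> carrier_mat d d \<and> foldr (*) Ms X = foldr (*) Ms (1\<^sub>m d) * X"
    using assms
  proof (induction Ms)
    case (Cons M Ms)
    then have M: "M \<in> carrier_mat d d" and "foldr (*) Ms (1\<^sub>m d) \<in> carrier_mat d d"
      and "foldr (*) Ms X = foldr (*) Ms (1\<^sub>m d) * X" by auto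
    then show ?case using Cons.prems(2) by (simp add: assoc_mult_mat[OF M])
  qed simp
  then show "foldr (*) Ms (1\<^sub>m d) \<in> carrier_mat d d"
    and "foldr (*) Ms X = foldr (*) Ms (1\<^sub>m d) * X" by auto
qed

lemma companion_matrix_carrier [simp]: "companion_matrix d a \<in> carrier_mat d d"
  by (simp add: companion_matrix_def)

lemma A_matrix_carrier [simp]: "A_matrix \<sigma> k d a \<in> carrier_mat d d"
  unfolding A_matrix_def by (rule foldr_mult_mat(1)[where X = "1\<^sub>m d"]) auto

lemma A_matrix_0: "A_matrix \<sigma> 0 d a = 1\<^sub>m d"
  by (simp add: A_matrix_def)

text \<open>The product grows on the right, where a row vector meets the next factor;
  \<open>foldr_mult_mat\<close> moves that factor out of the fold.\<close>

lemma A_matrix_Suc: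
  "A_matrix \<sigma> (Suc k) d a = A_matrix \<sigma> k d a * map_mat (\<sigma> ^^ k) (companion_matrix d a)"
  using right_mult_one_mat[of "map_mat (\<sigma> ^^ k) (companion_matrix d a)" d d]
  unfolding A_matrix_def by simp (rule foldr_mult_mat(2), auto)

text \<open>On row vectors the companion matrix is a shift. For nonzero \<open>a d\<close> the value
  filled in at the end is the v_d solving a_0 v_0 + ... + a_d v_d = 0.\<close>

lemma sum_companion_matrix:
  fixes v :: "nat \<Rightarrow> 'a::field"
  assumes "j < d"
  shows "(\<Sum>i<d. v i * companion_matrix d a $$ (i, j)) =
    (if Suc j < d then v (Suc j) else - (\<Sum>i<d. a i * v i) / a d)"
proof (cases "Suc j < d")
  case True
  have "(\<Sum>i<d. v i * companion_matrix d a $$ (i, j)) = (\<Sum>i<d. if i = Suc j then v i else 0)"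
    using True by (intro sum.cong) (auto simp: companion_matrix_def)
  with True show ?thesis by simp
next
  case False
  with assms have "j = d - 1" by simp
  then have "(\<Sum>i<d. v i * companion_matrix d a $$ (i, j)) = (\<Sum>i<d. - (a i * v i) / a d)"
    using assms by (intro sum.cong) (auto simp: companion_matrix_def)
  with False show ?thesis by (simp add: sum_negf sum_divide_distrib)
qed

lemma sigma_pow_Suc: "sigma_pow \<sigma> y (Suc i) = sigma_pow \<sigma> y i * (\<sigma> ^^ i) y"
  by (simp add: sigma_pow_def)

text \<open>Splits off the first factor rather than the last, the form in which the fixed-point
  equation generates the twisted powers of \<alpha>.\<close>

lemma sigma_pow_Suc_shift:
  assumes "\<sigma> \<in> carrier (galois_group K)"
  shows "sigma_pow \<sigma> y (Suc i) = y * \<sigma> (sigma_pow \<sigma> y i)"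
proof (induction i)
  case 0
  then show ?case by (simp add: sigma_pow_def galois_groupD(6)[OF assms])
next
  case (Suc i)
  have "sigma_pow \<sigma> y (Suc (Suc i)) = y * (\<sigma> (sigma_pow \<sigma> y i) * \<sigma> ((\<sigma> ^^ i) y))"
    unfolding sigma_pow_Suc[of _ _ "Suc i"] Suc by (simp add: mult.assoc)
  then show ?case by (simp add: sigma_pow_Suc[of _ _ i] galois_groupD(3)[OF assms])
qed

text \<open>\<open>v \<mapsto> \<sigma>\<^sup>-\<^sup>1(v C\<^sub>L / \<alpha>)\<close> on row vectors of length \<open>d\<close>, which are encoded as functions vanishing
  from \<open>d\<close> on.\<close>

definition companion_op :: "('a::field \<Rightarrow> 'a) \<Rightarrow> nat \<Rightarrow> (nat \<Rightarrow> 'a) \<Rightarrow> 'a \<Rightarrow> (nat \<Rightarrow> 'a) \<Rightarrow> nat \<Rightarrow> 'a" where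
  "companion_op \<sigma> d a \<alpha> v =
     (\<lambda>j. if j < d then inv_into UNIV \<sigma> ((\<Sum>i<d. v i * companion_matrix d a $$ (i, j)) / \<alpha>) else 0)"

text \<open>Being fixed means v_(j+1) = \<alpha> \<sigma>(v_j), so x = v_0 determines
  \<open>v\<close>; the last column then says that x is a root of L_\<alpha>.\<close>

lemma companion_op_fixed_iff:
  assumes \<sigma>: "\<sigma> \<in> carrier (galois_group K)" and "\<alpha> \<noteq> 0" "a d \<noteq> 0" "d \<ge> 1"
  shows "companion_op \<sigma> d a \<alpha> v = v \<longleftrightarrow>
    (\<exists>x. lin_map \<sigma> d (twist_coeffs \<sigma> \<alpha> a) x = 0 \<and>
      v = (\<lambda>j. if j < d then sigma_pow \<sigma> \<alpha> j * (\<sigma> ^^ j) x else 0))"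
proof -
  note \<sigma>D = galois_groupD[OF \<sigma>]
  \<comment> \<open>The fixed vector is this sequence cut off at \<open>d\<close>; the entry at
    \<open>d\<close> itself carries the leading term of L_\<alpha>.\<close>
  define w where "w x j = sigma_pow \<sigma> \<alpha> j * (\<sigma> ^^ j) x" for x j
  have w0: "w x 0 = x" for x by (simp add: w_def sigma_pow_def)
  have wSuc: "w x (Suc j) = \<alpha> * \<sigma> (w x j)" for x j
    by (simp add: w_def sigma_pow_Suc_shift[OF \<sigma>] \<sigma>D(3))
  have L: "lin_map \<sigma> d (twist_coeffs \<sigma> \<alpha> a) x = (\<Sum>i<d. a i * w x i) + a d * w x d" for x
    by (simp add: lin_map_def twist_coeffs_def w_def mult.assoc flip: lessThan_Suc_atMost)
  have inv_eq: "inv_into UNIV \<sigma> y = z \<longleftrightarrow> y = \<sigma> z" for y z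
    using \<sigma>D(1) by (metis bij_inv_eq_iff)
  have div_eq: "y / \<alpha> = z \<longleftrightarrow> y = \<alpha> * z" for y z
    using \<open>\<alpha> \<noteq> 0\<close> by (simp add: divide_eq_eq mult.commute)
  have fixed: "companion_op \<sigma> d a \<alpha> v = v \<longleftrightarrow>
    (\<forall>j\<ge>d. v j = 0) \<and> (\<forall>j<d. (if Suc j < d then v (Suc j) else - (\<Sum>i<d. a i * v i) / a d) = \<alpha> * \<sigma> (v j))"
    for v
  proof -
    have "companion_op \<sigma> d a \<alpha> v = v \<longleftrightarrow> (\<forall>j. companion_op \<sigma> d a \<alpha> v j = v j)"
      by (simp add: fun_eq_iff)
    also have "\<dots> \<longleftrightarrow> (\<forall>j\<ge>d. companion_op \<sigma> d a \<alpha> v j = v j) \<and> (\<forall>j<d. companion_op \<sigma> d a \<alpha> v j = v j)"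
      by (meson not_less)
    also have "(\<forall>j\<ge>d. companion_op \<sigma> d a \<alpha> v j = v j) \<longleftrightarrow> (\<forall>j\<ge>d. v j = 0)"
      by (auto simp: companion_op_def)
    also have "(\<forall>j<d. companion_op \<sigma> d a \<alpha> v j = v j) \<longleftrightarrow>
      (\<forall>j<d. (if Suc j < d then v (Suc j) else - (\<Sum>i<d. a i * v i) / a d) = \<alpha> * \<sigma> (v j))"
      by (intro all_cong) (simp add: companion_op_def sum_companion_matrix inv_eq div_eq)
    finally show ?thesis .
  qed
  have "companion_op \<sigma> d a \<alpha> v = v \<longleftrightarrow>
    (\<exists>x. lin_map \<sigma> d (twist_coeffs \<sigma> \<alpha> a) x = 0 \<and> v = (\<lambda>j. if j < d then w x j else 0))"
  proof
    assume v: "companion_op \<sigma> d a \<alpha> v = v"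
    then have supp: "v j = 0" if "j \<ge> d" for j
      using that unfolding fixed by blast
    have rec: "(if Suc j < d then v (Suc j) else - (\<Sum>i<d. a i * v i) / a d) = \<alpha> * \<sigma> (v j)"
      if "j < d" for j
      using that v unfolding fixed by blast
    have step: "v (Suc j) = \<alpha> * \<sigma> (v j)" if "Suc j < d" for j
      using rec[of j] that by simp
    have last: "- (\<Sum>i<d. a i * v i) / a d = \<alpha> * \<sigma> (v (d - 1))"
      using rec[of "d - 1"] \<open>d \<ge> 1\<close> by simp
    have vw: "w (v 0) j = v j" if "j < d" for j
      using that by (induction j) (simp_all add: w0 wSuc step)
    have "w (v 0) d = \<alpha> * \<sigma> (v (d - 1))"
      using wSuc[of "v 0" "d - 1"] vw[of "d - 1"] \<open>d \<ge> 1\<close> by simp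
    also have "\<dots> = - (\<Sum>i<d. a i * w (v 0) i) / a d"
      unfolding last[symmetric] by (simp add: vw)
    finally have "lin_map \<sigma> d (twist_coeffs \<sigma> \<alpha> a) (v 0) = 0"
      unfolding L using \<open>a d \<noteq> 0\<close> by simp
    then show "\<exists>x. lin_map \<sigma> d (twist_coeffs \<sigma> \<alpha> a) x = 0 \<and> v = (\<lambda>j. if j < d then w x j else 0)"
      by (intro exI[of _ "v 0"] conjI ext) (auto simp: supp vw not_less)
  next
    assume "\<exists>x. lin_map \<sigma> d (twist_coeffs \<sigma> \<alpha> a) x = 0 \<and> v = (\<lambda>j. if j < d then w x j else 0)"
    then obtain x where x: "(\<Sum>i<d. a i * w x i) + a d * w x d = 0"
      and v: "v = (\<lambda>j. if j < d then w x j else 0)" by (auto simp: L)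
    have "- (\<Sum>i<d. a i * v i) / a d = w x d"
    proof -
      have "(\<Sum>i<d. a i * v i) = (\<Sum>i<d. a i * w x i)" by (simp add: v)
      then have "- (\<Sum>i<d. a i * v i) = w x d * a d"
        using x by (simp add: add_eq_0_iff mult.commute)
      then show ?thesis using \<open>a d \<noteq> 0\<close> by (metis nonzero_mult_div_cancel_right)
    qed
    moreover have "w x d = \<alpha> * \<sigma> (v j)" if "j < d" "\<not> Suc j < d" for j
      using that wSuc[of x j] by (simp add: v) (metis Suc_lessI)
    ultimately show "companion_op \<sigma> d a \<alpha> v = v"
      unfolding fixed by (auto simp: v wSuc)
  qed
  then show ?thesis unfolding w_def .
qed

text \<open>The root is recovered as entry 0 of its fixed vector, which exists since
  \<open>d \<ge> 1\<close>.\<close>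

lemma card_companion_op_fixed:
  assumes \<sigma>: "\<sigma> \<in> carrier (galois_group K)" and "\<alpha> \<noteq> 0" "a d \<noteq> 0" "d \<ge> 1"
  shows "card {v. companion_op \<sigma> d a \<alpha> v = v} = card {x. lin_map \<sigma> d (twist_coeffs \<sigma> \<alpha> a) x = 0}"
proof -
  let ?w = "\<lambda>x j. if j < d then sigma_pow \<sigma> \<alpha> j * (\<sigma> ^^ j) x else 0"
  have "{v. companion_op \<sigma> d a \<alpha> v = v} = ?w ` {x. lin_map \<sigma> d (twist_coeffs \<sigma> \<alpha> a) x = 0}"
    unfolding companion_op_fixed_iff[where a = a and d = d, OF assms] by auto
  moreover have "?w x 0 = x" for x using \<open>d \<ge> 1\<close> by (simp add: sigma_pow_def)
  then have "inj_on ?w A" for A by (intro inj_on_inverseI[where g = "\<lambda>v. v 0"])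
  ultimately show ?thesis by (simp add: card_image)
qed

text \<open>Multiplying \<sigma>^(-k)(S) by C_L gives \<sigma>^(-k) of S times the \<sigma>^k-twist
  of C_L. Each iteration thus adds the next factor of A_L, and the divisors collect into
  \<open>sigma_pow \<sigma> \<alpha> k\<close>. The support condition matters at k = 0, where
  nothing truncates \<open>v\<close>.\<close>

lemma companion_op_funpow:
  assumes \<sigma>: "\<sigma> \<in> carrier (galois_group K)" and supp: "\<And>i. i \<ge> d \<Longrightarrow> v i = 0"
  shows "(companion_op \<sigma> d a \<alpha> ^^ k) v =
    (\<lambda>j. if j < d then (inv_into UNIV \<sigma> ^^ k) ((\<Sum>i<d. v i * A_matrix \<sigma> k d a $$ (i, j)) / sigma_pow \<sigma> \<alpha> k) else 0)"
proof (induction k)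
  case 0
  have "(\<Sum>i<d. v i * 1\<^sub>m d $$ (i, j)) = v j" if "j < d" for j
  proof -
    have "(\<Sum>i<d. v i * 1\<^sub>m d $$ (i, j)) = (\<Sum>i<d. if i = j then v i else 0)"
      using that by (intro sum.cong) auto
    then show ?thesis using that by simp
  qed
  then show ?case using supp by (auto simp: A_matrix_0 sigma_pow_def fun_eq_iff)
next
  case (Suc k)
  let ?C = "companion_matrix d a" and ?A = "\<lambda>k. A_matrix \<sigma> k d a" and ?\<tau> = "inv_into UNIV \<sigma>"
  have \<tau>k: "?\<tau> ^^ k \<in> carrier (galois_group K)" and \<sigma>k: "\<sigma> ^^ k \<in> carrier (galois_group K)"
    using galois_group_closed[OF \<sigma>] galois_group_closed(2) by blast+
  note hom = galois_groupD[OF \<tau>k] galois_group_divide[OF \<tau>k] galois_group_sum[OF \<tau>k]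
  have cancel: "(?\<tau> ^^ k) ((\<sigma> ^^ k) x) = x" for x
    using inv_fn_o_fn_is_id[OF galois_groupD(1)[OF \<sigma>], of k] by (simp add: fun_eq_iff)
  have "(\<Sum>l<d. (?\<tau> ^^ k) ((\<Sum>i<d. v i * ?A k $$ (i, l)) / sigma_pow \<sigma> \<alpha> k) * ?C $$ (l, j)) / \<alpha>
      = (?\<tau> ^^ k) ((\<Sum>i<d. v i * ?A (Suc k) $$ (i, j)) / sigma_pow \<sigma> \<alpha> (Suc k))" if j: "j < d" for j
  proof -
    have entry: "?A (Suc k) $$ (i, j) = (\<Sum>l<d. ?A k $$ (i, l) * (\<sigma> ^^ k) (?C $$ (l, j)))" if "i < d" for i
    proof -
      have "?A (Suc k) $$ (i, j) = row (?A k) i \<bullet> col (map_mat (\<sigma> ^^ k) ?C) j"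
        unfolding A_matrix_Suc using that j carrier_matD[OF A_matrix_carrier[of \<sigma> k d a]]
          carrier_matD[OF companion_matrix_carrier[of d a]] by simp
      also have "\<dots> = (\<Sum>l<d. ?A k $$ (i, l) * (\<sigma> ^^ k) (?C $$ (l, j)))"
        using that j carrier_matD[OF A_matrix_carrier[of \<sigma> k d a]]
          carrier_matD[OF companion_matrix_carrier[of d a]]
        by (simp add: scalar_prod_def atLeast0LessThan)
      finally show ?thesis .
    qed
    define S where "S l = (\<Sum>i<d. v i * ?A k $$ (i, l))" for l
    have "(\<Sum>i<d. v i * ?A (Suc k) $$ (i, j)) = (\<Sum>i<d. \<Sum>l<d. v i * ?A k $$ (i, l) * (\<sigma> ^^ k) (?C $$ (l, j)))"
      by (intro sum.cong) (simp_all add: entry sum_distrib_left mult.assoc)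
    also have "\<dots> = (\<Sum>l<d. S l * (\<sigma> ^^ k) (?C $$ (l, j)))"
      unfolding S_def by (subst sum.swap) (simp add: sum_distrib_right)
    finally have "(\<Sum>i<d. v i * ?A (Suc k) $$ (i, j)) / sigma_pow \<sigma> \<alpha> (Suc k) =
      (\<Sum>l<d. S l / sigma_pow \<sigma> \<alpha> k * (\<sigma> ^^ k) (?C $$ (l, j))) / (\<sigma> ^^ k) \<alpha>"
      by (simp add: sigma_pow_Suc sum_divide_distrib)
    \<comment> \<open>\<open>hom\<close> carries \<sigma>^(-k) inside the sum and quotients, and
      \<open>cancel\<close> untwists the entries of C_L and the last factor \<alpha>.\<close>
    then show ?thesis by (simp only: hom cancel S_def)
  qed
  then show ?case
    unfolding funpow.simps comp_apply Suc by (simp add: companion_op_def fun_eq_iff)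
qed

text \<open>At k = n the power of the inverse of \<sigma> is the identity and the divisor is the
  norm, so being fixed means v A_L = N(\<alpha>) v: a left kernel.\<close>

lemma card_companion_op_funpow_fixed:
  fixes \<sigma> :: "'a::{field,finite} \<Rightarrow> 'a"
  assumes \<sigma>: "\<sigma> \<in> carrier (galois_group K)" "\<sigma> ^^ n = id" and "\<alpha> \<noteq> 0" "n > 0"
  shows "card {v. (companion_op \<sigma> d a \<alpha> ^^ n) v = v} =
    card (UNIV :: 'a set) ^ kernel_dim (A_matrix \<sigma> n d a - sigma_norm \<sigma> n \<alpha> \<cdot>\<^sub>m 1\<^sub>m d)"
proof -
  let ?A = "A_matrix \<sigma> n d a" and ?N = "sigma_norm \<sigma> n \<alpha>" and ?\<tau> = "inv_into UNIV \<sigma>"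
  let ?M = "?A - ?N \<cdot>\<^sub>m 1\<^sub>m d" and ?T = "companion_op \<sigma> d a \<alpha>"
  have A: "?A \<in> carrier_mat d d" and M: "?M \<in> carrier_mat d d"
    by (simp_all add: minus_carrier_mat)
  have N0: "?N \<noteq> 0"
  proof -
    have "(\<sigma> ^^ j) \<alpha> \<noteq> 0" for j
      using galois_group_eq_0_iff[OF galois_group_closed(2)[OF \<sigma>(1), of j]] \<open>\<alpha> \<noteq> 0\<close> by simp
    then show ?thesis by (simp add: sigma_norm_def)
  qed
  have \<tau>n: "?\<tau> ^^ n = id"
    using inv_fn_o_fn_is_id[OF galois_groupD(1)[OF \<sigma>(1)], of n] \<sigma>(2) by (simp add: fun_eq_iff)
  have fixed: "(?T ^^ n) v = v \<longleftrightarrow> (\<forall>i\<ge>d. v i = 0) \<and> (\<forall>j<d. (\<Sum>i<d. v i * ?A $$ (i, j)) = ?N * v j)" for v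
  proof (cases "\<forall>i\<ge>d. v i = 0")
    case True
    have Tn: "(?T ^^ n) v j = (if j < d then (\<Sum>i<d. v i * ?A $$ (i, j)) / ?N else 0)" for j
      using companion_op_funpow[OF \<sigma>(1), where d = d and v = v and k = n] True
      by (simp add: \<tau>n sigma_pow_def sigma_norm_def)
    have "(?T ^^ n) v = v \<longleftrightarrow> (\<forall>j<d. (\<Sum>i<d. v i * ?A $$ (i, j)) / ?N = v j)"
      unfolding fun_eq_iff Tn using True by (metis not_less)
    then show ?thesis using True N0 by (simp add: divide_eq_eq mult.commute)
  next
    case False
    \<comment> \<open>At least one application of the operator takes place, so the result vanishes
      from \<open>d\<close> on and cannot equal \<open>v\<close>.\<close>
    obtain m where "n = Suc m" using \<open>n > 0\<close> by (cases n) auto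
    then have "\<forall>i\<ge>d. (?T ^^ n) v i = 0" by (simp add: companion_op_def)
    with False show ?thesis by auto
  qed
  have ker: "u \<in> mat_kernel (transpose_mat ?M) \<longleftrightarrow>
    u \<in> carrier_vec d \<and> (\<forall>j<d. (\<Sum>i<d. u $ i * ?A $$ (i, j)) = ?N * u $ j)" for u
  proof -
    have "(transpose_mat ?M *\<^sub>v u) $ j = (\<Sum>i<d. u $ i * ?A $$ (i, j)) - ?N * u $ j"
      if "j < d" "u \<in> carrier_vec d" for j
    proof -
      have "(transpose_mat ?M *\<^sub>v u) $ j = (\<Sum>i<d. ?M $$ (i, j) * u $ i)"
        using that A by (simp add: scalar_prod_def atLeast0LessThan)
      also have "\<dots> = (\<Sum>i<d. u $ i * ?A $$ (i, j) - (if i = j then ?N * u $ i else 0))"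
        using that A by (intro sum.cong) (auto simp: algebra_simps)
      finally show ?thesis using that by (simp add: sum_subtractf)
    qed
    then show ?thesis
      unfolding mat_kernel[OF transpose_carrier_mat[THEN iffD2, OF M]] by (auto simp: vec_eq_iff)
  qed
  let ?F = "{v. (\<forall>i\<ge>d. v i = 0) \<and> (\<forall>j<d. (\<Sum>i<d. v i * ?A $$ (i, j)) = ?N * v j)}"
  have F: "{v. (?T ^^ n) v = v} = ?F" by (simp only: fixed)
  have "bij_betw (vec d) ?F (mat_kernel (transpose_mat ?M))"
    by (rule bij_betw_byWitness[where f' = "\<lambda>u j. if j < d then u $ j else 0"])
       (auto simp: ker intro!: ext eq_vecI)
  from bij_betw_same_card[OF this] show ?thesis
    unfolding F using card_mat_kernel_transpose[OF M] by simp
qed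

section \<open>Comparison of the two counts of fixed vectors\<close>

lemma nullity_twist_eq_kernel_dim:
  fixes q n d :: nat
    and K :: "'a::finite_field set"
  assumes q: "primepow q" "n > 0" and card: "card (UNIV :: 'a set) = q ^ n" "card K = q"
    and K: "subfield K class_ring" and gen: "galois_generator K \<sigma>"
    and L: "d \<ge> 1" "a d \<noteq> 0" and "\<alpha> \<noteq> 0"
  shows "nullity_over K (lin_map \<sigma> d (twist_coeffs \<sigma> \<alpha> a)) =
    kernel_dim (A_matrix \<sigma> n d a - sigma_norm \<sigma> n \<alpha> \<cdot>\<^sub>m 1\<^sub>m d)"
proof -
  note R = class_ring.ring_axioms
  let ?\<tau> = "inv_into UNIV \<sigma>" and ?T = "companion_op \<sigma> d a \<alpha>"
  have q1: "q > 1" using primepow_gt_Suc_0[OF q(1)] by simp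
  have \<sigma>: "\<sigma> \<in> carrier (galois_group K)" using gen by (simp add: galois_generator_def)
  have K0: "0 \<in> K" and Kmult: "\<And>x y. x \<in> K \<Longrightarrow> y \<in> K \<Longrightarrow> x * y \<in> K"
    using subringE(2,6)[OF subfieldE(1)[OF K]] by (simp_all add: class_ring_simps)
  have dim: "ring.dimension class_ring (ring.dim class_ring K UNIV) K (UNIV :: 'a set)"
    by (rule ring.dim_finite_subspace[OF R K]) (auto simp: class_ring_simps)
  \<comment> \<open>Counting the whole field identifies the degree of the extension with n.\<close>
  have "q ^ n = q ^ ring.dim class_ring K UNIV"
    using ring.card_dimension[OF R K _ dim] card by simp
  then have dim_n: "ring.dimension class_ring n K (UNIV :: 'a set)"
    using dim q1 by simp
  obtain b :: "nat \<Rightarrow> 'a" where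
    "\<forall>x\<in>UNIV. \<exists>k. (\<forall>j<n. k j \<in> K) \<and> x = (\<Sum>j<n. k j * b j)"
    using dimension_class_ring_spanning[OF K dim_n] by (elim exE)
  from bspec[OF this UNIV_I]
  have b: "\<exists>k. (\<forall>j<n. k j \<in> K) \<and> x = (\<Sum>j<n. k j * b j)" for x .
  have "card (carrier (galois_group K)) = n"
    using card_galois_group_le[OF K0 b] le_card_galois_group[OF q(1) card Kmult K0] by simp
  note ord = galois_generator_order[OF gen this \<open>n > 0\<close>]
  have \<tau>: "?\<tau> \<in> carrier (galois_group K)" "bij \<sigma>"
    using galois_group_closed(1)[OF \<sigma>] galois_groupD(1)[OF \<sigma>] by auto
  have \<tau>n: "?\<tau> ^^ n = id"
    using inv_fn[OF \<tau>(2), of n] ord(1) by simp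
  \<comment> \<open>The operator is semilinear for the inverse of \<sigma>, so the distinctness of
    powers is transferred by inverting.\<close>
  have "inj_on (\<lambda>i. ?\<tau> ^^ i) {..<n}"
  proof (rule inj_onI)
    fix i j assume ij: "i \<in> {..<n}" "j \<in> {..<n}" "?\<tau> ^^ i = ?\<tau> ^^ j"
    then have "inv_into UNIV (\<sigma> ^^ i) = inv_into UNIV (\<sigma> ^^ j)"
      using inv_fn[OF \<tau>(2)] by simp
    then have "\<sigma> ^^ i = \<sigma> ^^ j" using bij_fn[OF \<tau>(2)] by (metis inv_inv_eq)
    with ij ord(2) show "i = j" by (auto dest: inj_onD)
  qed
  then have det: "det (mat n n (\<lambda>(i, j). (?\<tau> ^^ i) (b j))) \<noteq> 0"
    using galois_groupD[OF galois_group_closed(2)[OF \<tau>(1)]] b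
    by (intro det_moore_nonzero[where K = K]) auto
  \<comment> \<open>The space consists of all functions on the naturals; vectors fixed by T or T^n
    vanish from \<open>d\<close> on anyway, so the counts are unaffected.\<close>
  define scale where "scale c v = (\<lambda>j. c * v j)" for c :: 'a and v :: "nat \<Rightarrow> 'a"
  have "vector_space scale"
    by unfold_locales (auto simp: scale_def fun_eq_iff algebra_simps)
  moreover have "?T (x + y) = ?T x + ?T y" for x y
    by (auto simp: companion_op_def fun_eq_iff distrib_right sum.distrib add_divide_distrib galois_groupD[OF \<tau>(1)])
  moreover have "?T (scale c x) = scale (?\<tau> c) (?T x)" for c x
    by (auto simp: companion_op_def fun_eq_iff scale_def mult.assoc galois_groupD[OF \<tau>(1)]
        simp flip: sum_distrib_left times_divide_eq_right)
  ultimately have "card {v. (?T ^^ n) v = v} = card {v. ?T v = v} ^ n"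
    using \<open>n > 0\<close> \<tau>n det by (rule card_fixed_points_semilinear)
  \<comment> \<open>Both sides count the fixed vectors of T^n: as a left kernel over a field of q^n
    elements, and as n-tuples of roots of L_\<alpha>.\<close>
  then have "(q ^ n) ^ kernel_dim (A_matrix \<sigma> n d a - sigma_norm \<sigma> n \<alpha> \<cdot>\<^sub>m 1\<^sub>m d) =
    (q ^ nullity_over K (lin_map \<sigma> d (twist_coeffs \<sigma> \<alpha> a))) ^ n"
    using card_companion_op_funpow_fixed[OF \<sigma> ord(1) \<open>\<alpha> \<noteq> 0\<close> \<open>n > 0\<close>, of d a] 
      card_companion_op_fixed[where a = a and d = d, OF \<sigma> \<open>\<alpha> \<noteq> 0\<close> L(2,1)] card_kernel_lin_map[OF K \<sigma>] card
    by simp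
  then show ?thesis
    using q1 \<open>n > 0\<close> by (simp add: mult.commute flip: power_mult)
qed

theorem theorem5:
  fixes q n d :: nat
    and K :: "'a::finite_field set"
    and \<sigma> :: "'a \<Rightarrow> 'a"
    and a :: "nat \<Rightarrow> 'a"
  assumes "primepow q" and "n \<ge> 1"
    and "card (UNIV :: 'a set) = q ^ n"
    and "subfield K class_ring" and "card K = q"
    and "galois_generator K \<sigma>"
    and "d \<ge> 1" and "a d \<noteq> 0" and "a 0 \<noteq> 0"
  shows "(\<forall>\<alpha>. \<alpha> \<noteq> 0 \<longrightarrow>
            nullity_over K (lin_map \<sigma> d (twist_coeffs \<sigma> \<alpha> a)) =
            kernel_dim (A_matrix \<sigma> n d a - sigma_norm \<sigma> n \<alpha> \<cdot>\<^sub>m 1\<^sub>m d)) \<and>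
         nullity_over K (lin_map \<sigma> d a) = kernel_dim (A_matrix \<sigma> n d a - 1\<^sub>m d)"
proof -
  have main: "nullity_over K (lin_map \<sigma> d (twist_coeffs \<sigma> \<alpha> a)) =
    kernel_dim (A_matrix \<sigma> n d a - sigma_norm \<sigma> n \<alpha> \<cdot>\<^sub>m 1\<^sub>m d)" if "\<alpha> \<noteq> 0" for \<alpha>
    using assms that by (intro nullity_twist_eq_kernel_dim[of q]) auto
  \<comment> \<open>The final claim is the case \<alpha> = 1, where L_\<alpha> = L and the norm is
    1.\<close>
  have "(\<sigma> ^^ i) 1 = 1" for i
    using assms(6) galois_groupD(6)[OF galois_group_closed(2)] unfolding galois_generator_def by blast
  then have "twist_coeffs \<sigma> 1 a = a" "sigma_norm \<sigma> n 1 = 1"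
    by (simp_all add: fun_eq_iff twist_coeffs_def sigma_pow_def sigma_norm_def)
  moreover have "1 \<cdot>\<^sub>m 1\<^sub>m d = (1\<^sub>m d :: 'a mat)" by (intro eq_matI) auto
  ultimately show ?thesis using main[of 1] main by simp
qed

end
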